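(* Let $d\in\mathbb{N}$ and let $F$ be a finite set of polynomials $f:\mathbb{Z}^d\to\mathbb{Z}$ such that $f(0)=0$. For any finite partition of $\mathbb{Z}^d$ there exist $a,b\in(\mathbb{Z}\setminus\{0\})^d$ such that the set $$\{b\}\cup\Big\{a+\big(f_1(b),\dots,f_d(b)\big):f_1,\dots,f_d\in F\Big\}$$ is contained in a single cell of the partition.
   Context: $\mathbb{N}=\{1,2,\dots\}$. *)

theory Defs
  imports "HOL-Analysis.Finite_Cartesian_Product" "HOL-Library.Disjoint_Sets"
begin

text \<open>
  Polynomials from \<open>\<int>\<^sup>d\<close> to \<open>\<int>\<close> are taken to be the integer-valued ones: the values at integer
  points are integers, but the coefficients may be rational, as in \<open>x (x - 1) / 2\<close>. Polynomials
  with integer coefficients are a special case. An exponent vector is a function \<open>\<alpha>\<close> from the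
  coordinate indices to \<open>nat\<close>, and \<open>S\<close> is a finite set of exponent vectors containing the support.
\<close>

definition polynomial_map :: "(int ^ 'd::finite \<Rightarrow> int) \<Rightarrow> bool" where
  "polynomial_map f \<longleftrightarrow>
     (\<exists>(S :: ('d \<Rightarrow> nat) set) (c :: ('d \<Rightarrow> nat) \<Rightarrow> rat). finite S \<and>
        (\<forall>x. of_int (f x) = (\<Sum>\<alpha>\<in>S. c \<alpha> * (\<Prod>i\<in>UNIV. of_int (x $ i) ^ \<alpha> i))))"

end

theory Submission
  imports Defs "HOL-Library.Multiset" "HOL-Library.Nat_Bijection" "HOL-Library.FuncSet"
begin

text \<open>
  An IP version of the polynomial van der Waerden theorem is proved by Walters' colour focusing and
  PET induction. Among the cells, restricted to the points without zero coordinates, choose a minimal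
  subfamily with thick union. Each of its members \<open>C\<close> is relatively syndetic, and the union contains
  all finite sums of some sequence. Colouring points by their return times to all members
  simultaneously yields a finite sum \<open>b\<close> such that every member \<open>C\<close> contains a configuration
  \<open>a + f(b)\<close>; the member containing \<open>b\<close> is the required cell.
\<close>

section \<open>Polynomial maps between abelian groups\<close>

text \<open>Polynomials of degree at most \<open>k\<close> vanishing at \<open>0\<close>.\<close>

fun poly0 :: "nat \<Rightarrow> ('a::ab_group_add \<Rightarrow> 'b::ab_group_add) set" where
  "poly0 0 = {\<lambda>_. 0}"
| "poly0 (Suc k) = {f. \<forall>h. (\<lambda>x. f (x + h) - f x - f h) \<in> poly0 k}"

text \<open>For \<open>h = 0\<close> the increment is the constant \<open>- f 0\<close>, and by
  induction it vanishes at \<open>0\<close>.\<close>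

lemma poly0_at_0: "f \<in> poly0 k \<Longrightarrow> f 0 = 0"
proof (induction k arbitrary: f)
  case (Suc k)
  then have "(\<lambda>x. f (x + 0) - f x - f 0) \<in> poly0 k" by (simp only: poly0.simps) blast
  from Suc.IH[OF this] show ?case by simp
qed simp

lemma zero_in_poly0: "(\<lambda>_. 0) \<in> poly0 k"
  by (induction k) auto

lemma poly0_Suc: "f \<in> poly0 k \<Longrightarrow> f \<in> poly0 (Suc k)"
proof (induction k arbitrary: f)
  case (Suc k)
  have "(\<lambda>x. f (x + h) - f x - f h) \<in> poly0 (Suc k)" for h
    by (rule Suc.IH) (use Suc.prems in simp)
  then show ?case by (subst poly0.simps(2)) blast
qed simp

lemma poly0_mono: "k \<le> l \<Longrightarrow> f \<in> poly0 k \<Longrightarrow> f \<in> poly0 l"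
  by (induction rule: dec_induct) (auto intro: poly0_Suc simp del: poly0.simps)

lemma poly0_add: "f \<in> poly0 k \<Longrightarrow> g \<in> poly0 k \<Longrightarrow> (\<lambda>x. f x + g x) \<in> poly0 k"
proof (induction k arbitrary: f g)
  case (Suc k)
  have "(\<lambda>x. (f (x + h) + g (x + h)) - (f x + g x) - (f h + g h)) \<in> poly0 k" for h
  proof -
    have "(\<lambda>x. (f (x + h) - f x - f h) + (g (x + h) - g x - g h)) \<in> poly0 k"
      using Suc by auto
    then show ?thesis by (simp add: algebra_simps)
  qed
  then show ?case by simp
qed simp

lemma poly0_diff: "f \<in> poly0 k \<Longrightarrow> g \<in> poly0 k \<Longrightarrow> (\<lambda>x. f x - g x) \<in> poly0 k"
proof (induction k arbitrary: f g)
  case (Suc k)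
  have "(\<lambda>x. (f (x + h) - g (x + h)) - (f x - g x) - (f h - g h)) \<in> poly0 k" for h
  proof -
    have "(\<lambda>x. (f (x + h) - f x - f h) - (g (x + h) - g x - g h)) \<in> poly0 k"
      using Suc by auto
    then show ?thesis by (simp add: algebra_simps)
  qed
  then show ?case by simp
qed simp

text \<open>Lets a tuple of polynomials be handled as a single polynomial map into a product
  group.\<close>

lemma poly0_vec:
  fixes g :: "'a::ab_group_add \<Rightarrow> 'b::ab_group_add ^ 'd"
  assumes "\<And>i. (\<lambda>x. g x $ i) \<in> poly0 k"
  shows "g \<in> poly0 k"
  using assms
proof (induction k arbitrary: g)
  case 0
  then show ?case by (auto simp: fun_eq_iff vec_eq_iff)
qed auto

section \<open>Iterated differences of ordinary polynomials\<close>

fun dpoly :: "nat \<Rightarrow> ('a::ab_group_add \<Rightarrow> 'b::ab_group_add) \<Rightarrow> bool" where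
  "dpoly 0 f \<longleftrightarrow> (\<exists>c. f = (\<lambda>_. c))"
| "dpoly (Suc k) f \<longleftrightarrow> (\<forall>h. dpoly k (\<lambda>x. f (x + h) - f x))"

lemma dpoly_const: "dpoly k (\<lambda>_. c)"
  by (induction k arbitrary: c) auto

lemma dpoly_Suc: "dpoly k f \<Longrightarrow> dpoly (Suc k) f"
proof (induction k arbitrary: f)
  case (Suc k)
  have "dpoly (Suc k) (\<lambda>x. f (x + h) - f x)" for h
    by (rule Suc.IH) (use Suc.prems in simp)
  then show ?case by (subst dpoly.simps(2)) blast
qed auto

lemma dpoly_mono: "k \<le> l \<Longrightarrow> dpoly k f \<Longrightarrow> dpoly l f"
  by (induction rule: dec_induct) (auto intro: dpoly_Suc simp del: dpoly.simps)

lemma dpoly_add: "dpoly k f \<Longrightarrow> dpoly k g \<Longrightarrow> dpoly k (\<lambda>x. f x + g x)"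
proof (induction k arbitrary: f g)
  case (Suc k)
  have "dpoly k (\<lambda>x. (f (x + h) + g (x + h)) - (f x + g x))" for h
  proof -
    have "dpoly k (\<lambda>x. (f (x + h) - f x) + (g (x + h) - g x))" using Suc by auto
    then show ?thesis by (simp add: algebra_simps)
  qed
  then show ?case by simp
qed auto

lemma dpoly_sum:
  assumes "\<And>s. s \<in> S \<Longrightarrow> \<exists>k. dpoly k (f s)" "finite S"
  shows "\<exists>k. dpoly k (\<lambda>x. \<Sum>s\<in>S. f s x)"
  using assms(2,1)
proof (induction S)
  case empty
  then show ?case by (simp add: dpoly_const)
next
  case (insert s S)
  then obtain k l where "dpoly k (f s)" "dpoly l (\<lambda>x. \<Sum>s\<in>S. f s x)" by blast
  then have "dpoly (max k l) (\<lambda>x. f s x + (\<Sum>s\<in>S. f s x))"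
    by (intro dpoly_add) (erule dpoly_mono[rotated], simp)+
  then show ?case using insert by auto
qed

lemma dpoly_cmult: "dpoly k g \<Longrightarrow> dpoly k (\<lambda>x. (c::'b::comm_ring_1) * g x)"
proof (induction k arbitrary: g)
  case (Suc k)
  have "dpoly k (\<lambda>x. c * g (x + h) - c * g x)" for h
    using Suc.IH[of "\<lambda>x. g (x + h) - g x"] Suc.prems by (simp add: right_diff_distrib)
  then show ?case by simp
qed auto

text \<open>Discrete Leibniz rule: the difference of a product is
  \<open>?f * ?g + ?f * g + f * ?g\<close>, with \<open>?f\<close> and \<open>?g\<close> the
  differences of the factors. Each summand has smaller total degree, whence the induction on
  \<open>k + l\<close>.\<close>

lemma dpoly_mult:
  fixes f g :: "'a::ab_group_add \<Rightarrow> 'b::comm_ring_1"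
  shows "dpoly k f \<Longrightarrow> dpoly l g \<Longrightarrow> dpoly (k + l) (\<lambda>x. f x * g x)"
proof (induction n \<equiv> "k + l" arbitrary: k l f g rule: less_induct)
  case less
  show ?case
  proof (cases k)
    case 0
    then obtain c where "f = (\<lambda>_. c)" using less by auto
    then show ?thesis using 0 dpoly_cmult[OF less.prems(2), of c] by simp
  next
    case k: (Suc k')
    show ?thesis
    proof (cases l)
      case 0
      then obtain c where "g = (\<lambda>_. c)" using less by auto
      then show ?thesis using 0 dpoly_cmult[OF less.prems(1), of c] by (simp add: mult.commute)
    next
      case l: (Suc l')
      have "dpoly (k + l') (\<lambda>x. f (x + h) * g (x + h) - f x * g x)" for h
      proof -
        let ?f = "\<lambda>x. f (x + h) - f x" and ?g = "\<lambda>x. g (x + h) - g x"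
        have f: "dpoly k' ?f" and g: "dpoly l' ?g" using less.prems k l by auto
        have 1: "dpoly (k' + l') (\<lambda>x. ?f x * ?g x)"
          by (rule less.hyps[OF _ f g]) (use k l in auto)
        have 2: "dpoly (k' + l) (\<lambda>x. ?f x * g x)"
          by (rule less.hyps[OF _ f less.prems(2)]) (use k l in auto)
        have 3: "dpoly (k + l') (\<lambda>x. f x * ?g x)"
          by (rule less.hyps[OF _ less.prems(1) g]) (use k l in auto)
        have "dpoly (k + l') (\<lambda>x. (?f x * ?g x + ?f x * g x) + f x * ?g x)"
          by (intro dpoly_add 3 dpoly_mono[OF _ 1] dpoly_mono[OF _ 2]) (use k l in auto)
        then show ?thesis by (simp add: algebra_simps)
      qed
      then show ?thesis using l by simp
    qed
  qed
qed

lemma dpoly_prod: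
  fixes f :: "'i \<Rightarrow> 'a::ab_group_add \<Rightarrow> 'b::comm_ring_1"
  assumes "\<And>s. s \<in> S \<Longrightarrow> \<exists>k. dpoly k (f s)" "finite S"
  shows "\<exists>k. dpoly k (\<lambda>x. \<Prod>s\<in>S. f s x)"
  using assms(2,1)
proof (induction S)
  case empty
  then show ?case by (simp add: dpoly_const)
next
  case (insert s S)
  then obtain k l where "dpoly k (f s)" "dpoly l (\<lambda>x. \<Prod>s\<in>S. f s x)" by blast
  then have "dpoly (k + l) (\<lambda>x. f s x * (\<Prod>s\<in>S. f s x))" by (rule dpoly_mult)
  then show ?case using insert by auto
qed

text \<open>Brings the degree bound back from the rationals, where the coefficients live.
  Differences commute with \<open>of_int\<close>, so injectivity is needed only in degree
  \<open>0\<close>.\<close>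

lemma dpoly_of_int_cancel:
  "dpoly k (\<lambda>x. of_int (f x) :: 'b::ring_char_0) \<Longrightarrow> dpoly k f"
proof (induction k arbitrary: f)
  case (Suc k)
  have "dpoly k (\<lambda>x. of_int (f (x + h) - f x) :: 'b)" for h
    using Suc.prems by simp
  then show ?case using Suc.IH by auto
next
  case 0
  then obtain c where "\<And>x. of_int (f x) = (c :: 'b)" by (auto simp: fun_eq_iff)
  then have "f x = f 0" for x by (metis of_int_eq_iff)
  then show ?case by auto
qed

text \<open>The \<open>poly0\<close> increment of \<open>f - f 0\<close> at \<open>h\<close> is the
  difference of \<open>f\<close> at \<open>h\<close>, normalised at \<open>0\<close>; the induction
  hypothesis applies to that difference.\<close>

lemma dpoly_imp_poly0: "dpoly k f \<Longrightarrow> (\<lambda>x. f x - f 0) \<in> poly0 k"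
proof (induction k arbitrary: f)
  case (Suc k)
  have "(\<lambda>x. (f (x + h) - f 0) - (f x - f 0) - (f h - f 0)) \<in> poly0 k" for h
  proof -
    have "dpoly k (\<lambda>x. f (x + h) - f x)" using Suc.prems by simp
    from Suc.IH[OF this] show ?thesis by (simp add: algebra_simps)
  qed
  then show ?case by simp
qed (auto simp: fun_eq_iff)

lemma polynomial_map_imp_poly0:
  assumes "polynomial_map f" "f 0 = 0"
  shows "\<exists>k. f \<in> poly0 k"
proof -
  obtain S c where S: "finite S"
    and eq: "\<And>x. (of_int (f x) :: rat) = (\<Sum>\<alpha>\<in>S. c \<alpha> * (\<Prod>i\<in>UNIV. of_int (x $ i) ^ \<alpha> i))"
    using assms(1) unfolding polynomial_map_def by blast
  have "dpoly (Suc 0) (\<lambda>x. of_int (x $ i) :: rat)" for i :: 'a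
    by (auto intro!: exI[of _ "of_int (h $ i)" for h])
  \<comment> \<open>A power is written as a product of equal factors, so that
    \<open>dpoly_prod\<close> covers it.\<close>
  then have "\<exists>k. dpoly k (\<lambda>x. \<Prod>j<n. of_int (x $ i) :: rat)" for i :: 'a and n :: nat
    by (intro dpoly_prod) blast+
  then have *: "\<exists>k. dpoly k (\<lambda>x. \<Prod>i\<in>UNIV. of_int (x $ i) ^ \<alpha> i :: rat)" for \<alpha> :: "'a \<Rightarrow> nat"
    by (intro dpoly_prod) auto
  then have "\<exists>k. dpoly k (\<lambda>x. \<Sum>\<alpha>\<in>S. c \<alpha> * (\<Prod>i\<in>UNIV. of_int (x $ i) ^ \<alpha> i))"
    by (intro dpoly_sum S) (rule ex_forward[OF *], erule dpoly_cmult)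
  then obtain k where "dpoly k (\<lambda>x. of_int (f x) :: rat)" using eq by auto
  from dpoly_imp_poly0[OF dpoly_of_int_cancel[OF this]] show ?thesis using assms(2) by auto
qed

section \<open>The IP polynomial van der Waerden theorem\<close>

text \<open>A configuration focused at \<open>x\<close>, whose parameter is a finite sum with
  indices in \<open>I\<close>. The colour \<open>c\<close> is kept separate from the colour of
  \<open>x\<close>, since focusing collects configurations of several colours at one point.\<close>

definition mono_config ::
  "(nat \<Rightarrow> 'a::ab_group_add) \<Rightarrow> ('a \<Rightarrow> 'b::ab_group_add) set \<Rightarrow> 'b set \<Rightarrow> nat set \<Rightarrow> ('b \<Rightarrow> nat) \<Rightarrow> 'b \<Rightarrow> nat \<Rightarrow> bool"
where
  "mono_config b A B I \<phi> x c \<longleftrightarrow>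
     (\<exists>\<alpha>. \<alpha> \<noteq> {} \<and> \<alpha> \<subseteq> I \<and> (\<forall>f\<in>A. x + f (sum b \<alpha>) \<in> B \<and> \<phi> (x + f (sum b \<alpha>)) = c))"

lemma mono_configI:
  assumes "\<alpha> \<noteq> {}" "\<alpha> \<subseteq> I" "\<And>f. f \<in> A \<Longrightarrow> x + f (sum b \<alpha>) \<in> B \<and> \<phi> (x + f (sum b \<alpha>)) = c"
  shows "mono_config b A B I \<phi> x c"
  unfolding mono_config_def using assms by (intro exI[of _ \<alpha>]) simp

text \<open>The set \<open>B\<close> makes the statement finitary, so that it can be applied to translates and to
  product colourings.\<close>

definition vdw :: "(nat \<Rightarrow> 'a::ab_group_add) \<Rightarrow> ('a \<Rightarrow> 'b::ab_group_add) set \<Rightarrow> bool" where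
  "vdw b A \<longleftrightarrow> (\<forall>m K. finite K \<longrightarrow> (\<exists>B n. finite B \<and>
     (\<forall>\<phi>. \<phi> ` B \<subseteq> K \<longrightarrow> (\<exists>x\<in>B. mono_config b A B {m..<m + n} \<phi> x (\<phi> x)))))"

lemma vdwE:
  assumes "vdw b A" "finite K"
  obtains B n where "finite B"
    "\<And>\<phi>. \<phi> ` B \<subseteq> K \<Longrightarrow> \<exists>x\<in>B. mono_config b A B {m..<m + n} \<phi> x (\<phi> x)"
proof -
  have "\<exists>B n. finite B \<and> (\<forall>\<phi>. \<phi> ` B \<subseteq> K \<longrightarrow> (\<exists>x\<in>B. mono_config b A B {m..<m + n} \<phi> x (\<phi> x)))"
    using assms unfolding vdw_def by simp
  then obtain B n where B: "finite B"
    and \<phi>: "\<forall>\<phi>. \<phi> ` B \<subseteq> K \<longrightarrow> (\<exists>x\<in>B. mono_config b A B {m..<m + n} \<phi> x (\<phi> x))"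
    by (elim exE conjE)
  from B show ?thesis by (rule that) (rule \<phi>[rule_format])
qed

text \<open>The differencing operation of PET induction: shift the parameter by an earlier sum
  \<open>y\<close>, renormalise, and subtract the pivot \<open>p\<close>.\<close>

definition shifted :: "('a::ab_group_add \<Rightarrow> 'b::ab_group_add) set \<Rightarrow> 'a set \<Rightarrow> ('a \<Rightarrow> 'b) \<Rightarrow> ('a \<Rightarrow> 'b) set"
  where "shifted A Y p = (\<lambda>(f, y) x. f (x + y) - f y - p x) ` (A \<times> Y)"

text \<open>Colour focusing: each of the \<open>s\<close> colours in \<open>C\<close> belongs to a configuration focused at \<open>x\<close>.
  Moving the focus by \<open>- p(b)\<close> turns the old configurations, and the old focus itself, into
  values of polynomials in \<open>shifted A Y p\<close>, so they keep their colours.\<close>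

lemma vdw_focus:
  fixes b :: "nat \<Rightarrow> 'a::ab_group_add" and A :: "('a \<Rightarrow> 'b::ab_group_add) set"
  assumes fin: "finite A"
    and zero: "\<forall>f\<in>A. f 0 = 0"
    and step: "\<forall>Y. finite Y \<longrightarrow> vdw b (shifted A Y p)"
    and K: "finite K"
  shows "\<exists>B n. finite B \<and> (\<forall>\<phi>. \<phi> ` B \<subseteq> K \<longrightarrow>
     (\<exists>x\<in>B. mono_config b A B {m..<m + n} \<phi> x (\<phi> x)) \<or>
     (\<exists>x\<in>B. \<exists>C\<subseteq>K. card C = s \<and> \<phi> x \<notin> C \<and> (\<forall>c\<in>C. mono_config b A B {m..<m + n} \<phi> x c)))"
proof (induction s)
  case 0
  show ?case by (rule exI[of _ "{0}"], rule exI[of _ 0]) auto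
next
  case (Suc s)
  obtain B n where B: "finite B" and focus: "\<And>\<phi>. \<phi> ` B \<subseteq> K \<Longrightarrow>
     (\<exists>x\<in>B. mono_config b A B {m..<m + n} \<phi> x (\<phi> x)) \<or>
     (\<exists>x\<in>B. \<exists>C\<subseteq>K. card C = s \<and> \<phi> x \<notin> C \<and> (\<forall>c\<in>C. mono_config b A B {m..<m + n} \<phi> x c))"
    using Suc.IH by blast
  obtain vs where vs: "set vs = B" using finite_list[OF B] by blast
  \<comment> \<open>All sums over the old index window. The empty sum \<open>0\<close> is included;
    it takes care of the old focus.\<close>
  define Y where "Y = sum b ` Pow {m..<m + n}"
  \<comment> \<open>Colours of the product colouring, which records at \<open>z\<close> the colours
    of the whole translate \<open>z + B\<close>; lists are encoded because colours are natural
    numbers.\<close>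
  define K' where "K' = list_encode ` {xs. set xs \<subseteq> K \<and> length xs = length vs}"
  have "finite K'" unfolding K'_def using K by (intro finite_imageI finite_lists_length_eq)
  have "vdw b (shifted A Y p)" using step by (simp add: Y_def)
  \<comment> \<open>The new window starts at \<open>m + n\<close>, so its index sets are disjoint
    from the old ones and their sums add.\<close>
  then obtain B' n' where B': "finite B'"
    and mono: "\<And>\<phi>. \<phi> ` B' \<subseteq> K' \<Longrightarrow>
      \<exists>z\<in>B'. mono_config b (shifted A Y p) B' {m + n..<m + n + n'} \<phi> z (\<phi> z)"
    using \<open>finite K'\<close> by (rule vdwE[where m = "m + n"]) blast
  define B1 where "B1 = (\<lambda>(u, v). u + v) ` (B' \<times> B)"
  \<comment> \<open>Besides the translates of \<open>B\<close>, room is made for every possible new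
    focus.\<close>
  define B2 where "B2 = B1 \<union> (\<lambda>(u, \<beta>). u - p (sum b \<beta>)) ` (B1 \<times> Pow {m + n..<m + n + n'})"
  have B1I: "u \<in> B' \<Longrightarrow> v \<in> B \<Longrightarrow> u + v \<in> B1" for u v unfolding B1_def by auto
  have sub: "B1 \<subseteq> B2" unfolding B2_def by auto
  have "finite B2" unfolding B1_def B2_def using B B' by auto
  moreover have "(\<exists>x\<in>B2. mono_config b A B2 {m..<m + (n + n')} \<phi> x (\<phi> x)) \<or>
     (\<exists>x\<in>B2. \<exists>C\<subseteq>K. card C = Suc s \<and> \<phi> x \<notin> C \<and>
        (\<forall>c\<in>C. mono_config b A B2 {m..<m + (n + n')} \<phi> x c))"
    if \<phi>: "\<phi> ` B2 \<subseteq> K" for \<phi>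
  proof -
    let ?X = "\<lambda>z. list_encode (map (\<lambda>v. \<phi> (z + v)) vs)"
    have \<phi>1: "\<phi> (u + v) \<in> K" if "u \<in> B'" "v \<in> B" for u v
      using \<phi> B1I[OF that] sub by auto
    have "?X ` B' \<subseteq> K'"
      unfolding K'_def using \<phi>1 vs by (intro image_subsetI imageI) auto
    from mono[OF this] obtain z \<beta> where \<beta>: "\<beta> \<noteq> {}" "\<beta> \<subseteq> {m + n..<m + n + n'}" and z: "z \<in> B'"
      and g: "\<And>g. g \<in> shifted A Y p \<Longrightarrow> z + g (sum b \<beta>) \<in> B'"
      and gX: "\<And>g. g \<in> shifted A Y p \<Longrightarrow> ?X (z + g (sum b \<beta>)) = ?X z"
      unfolding mono_config_def by blast
    have same: "\<phi> (z + g (sum b \<beta>) + v) = \<phi> (z + v)" if "g \<in> shifted A Y p" "v \<in> B" for g v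
    proof -
      have "map (\<lambda>v. \<phi> (z + g (sum b \<beta>) + v)) vs = map (\<lambda>v. \<phi> (z + v)) vs"
        using gX[OF that(1)] by (simp only: list_encode_eq)
      then show ?thesis using that(2) vs by (simp only: map_eq_conv)
    qed
    have "(\<lambda>v. \<phi> (z + v)) ` B \<subseteq> K" using \<phi>1 z by auto
    from focus[OF this] consider
      (1) x where "x \<in> B" "mono_config b A B {m..<m + n} (\<lambda>v. \<phi> (z + v)) x (\<phi> (z + x))"
      | (2) x C where "x \<in> B" "C \<subseteq> K" "card C = s" "\<phi> (z + x) \<notin> C"
          "\<forall>c\<in>C. mono_config b A B {m..<m + n} (\<lambda>v. \<phi> (z + v)) x c" by blast
    then show ?thesis
    proof cases
      case 1
      then obtain \<alpha> where \<alpha>: "\<alpha> \<noteq> {}" "\<alpha> \<subseteq> {m..<m + n}"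
        and f: "\<And>f. f \<in> A \<Longrightarrow> x + f (sum b \<alpha>) \<in> B \<and> \<phi> (z + (x + f (sum b \<alpha>))) = \<phi> (z + x)"
        unfolding mono_config_def by blast
      have "z + x + f (sum b \<alpha>) \<in> B2 \<and> \<phi> (z + x + f (sum b \<alpha>)) = \<phi> (z + x)" if "f \<in> A" for f
        using B1I[OF z, of "x + f (sum b \<alpha>)"] f[OF that] sub by (auto simp: add.assoc)
      moreover have "z + x \<in> B2" using B1I[OF z] 1 sub by auto
      moreover have "\<alpha> \<subseteq> {m..<m + (n + n')}" using \<alpha> by auto
      ultimately have "mono_config b A B2 {m..<m + (n + n')} \<phi> (z + x) (\<phi> (z + x))"
        using \<alpha>(1) by (intro mono_configI[of \<alpha>])
      then show ?thesis using \<open>z + x \<in> B2\<close> by blast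
    next
      case 2
      define X where "X = z + x - p (sum b \<beta>)"
      have X: "X \<in> B2" unfolding X_def B2_def using \<beta> B1I[OF z 2(1)] by auto
      \<comment> \<open>After splitting the sum over \<open>\<alpha> \<union> \<beta>\<close>, the
        term \<open>- p (sum b \<beta>)\<close> in \<open>X\<close> turns \<open>f\<close> into a
        member of \<open>shifted A Y p\<close> evaluated at \<open>sum b \<beta>\<close>; the
        product colouring does not see that displacement.\<close>
      have key: "X + f (sum b (\<alpha> \<union> \<beta>)) \<in> B2 \<and>
          \<phi> (X + f (sum b (\<alpha> \<union> \<beta>))) = \<phi> (z + (x + f (sum b \<alpha>)))"
        if f: "f \<in> A" and \<alpha>: "\<alpha> \<subseteq> {m..<m + n}" and v: "x + f (sum b \<alpha>) \<in> B" for f \<alpha>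
      proof -
        let ?g = "\<lambda>x. f (x + sum b \<alpha>) - f (sum b \<alpha>) - p x"
        have g': "?g \<in> shifted A Y p"
          unfolding shifted_def Y_def using f \<alpha> by (intro image_eqI[of _ _ "(f, sum b \<alpha>)"]) auto
        have "finite \<alpha>" "finite \<beta>" using \<alpha> \<beta> finite_subset by blast+
        moreover have "\<alpha> \<inter> \<beta> = {}" using \<alpha> \<beta> by fastforce
        ultimately have "sum b (\<alpha> \<union> \<beta>) = sum b \<beta> + sum b \<alpha>"
          by (simp add: sum.union_disjoint add.commute)
        then have "X + f (sum b (\<alpha> \<union> \<beta>)) = z + ?g (sum b \<beta>) + (x + f (sum b \<alpha>))"
          unfolding X_def by (simp add: algebra_simps)
        then show ?thesis using same[OF g' v] B1I[OF g[OF g'] v] sub by auto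
      qed
      have new: "mono_config b A B2 {m..<m + (n + n')} \<phi> X c" if c: "c \<in> insert (\<phi> (z + x)) C" for c
      proof (cases "c = \<phi> (z + x)")
        \<comment> \<open>The old focus supplies the additional colour, using \<open>\<beta>\<close>
          alone.\<close>
        case True
        have "X + f (sum b \<beta>) \<in> B2 \<and> \<phi> (X + f (sum b \<beta>)) = c" if "f \<in> A" for f
          using key[OF that, of "{}"] bspec[OF zero that] 2(1) True by simp
        moreover have "\<beta> \<subseteq> {m..<m + (n + n')}" using \<beta> by auto
        ultimately show ?thesis using \<beta>(1) by (intro mono_configI[of \<beta>])
      next
        case False
        then have "mono_config b A B {m..<m + n} (\<lambda>v. \<phi> (z + v)) x c" using c 2(5) by blast
        then obtain \<alpha> where \<alpha>: "\<alpha> \<noteq> {}" "\<alpha> \<subseteq> {m..<m + n}"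
          and f: "\<And>f. f \<in> A \<Longrightarrow> x + f (sum b \<alpha>) \<in> B \<and> \<phi> (z + (x + f (sum b \<alpha>))) = c"
          unfolding mono_config_def by blast
        have "X + f (sum b (\<alpha> \<union> \<beta>)) \<in> B2 \<and> \<phi> (X + f (sum b (\<alpha> \<union> \<beta>))) = c" if "f \<in> A" for f
          using key[OF that \<alpha>(2)] f[OF that] by simp
        moreover have "\<alpha> \<union> \<beta> \<subseteq> {m..<m + (n + n')}" using \<beta> \<alpha> by auto
        moreover have "\<alpha> \<union> \<beta> \<noteq> {}" using \<beta>(1) by auto
        ultimately show ?thesis by (intro mono_configI[of "\<alpha> \<union> \<beta>"])
      qed
      show ?thesis
      \<comment> \<open>Either the colour of \<open>X\<close> completes a monochromatic
        configuration, or \<open>X\<close> is a focus for one more colour.\<close>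
      proof (cases "\<phi> X \<in> insert (\<phi> (z + x)) C")
        case True
        then show ?thesis using new X by blast
      next
        case False
        have "finite C" using 2(2) K finite_subset by blast
        then have "card (insert (\<phi> (z + x)) C) = Suc s" using 2 by simp
        moreover have "insert (\<phi> (z + x)) C \<subseteq> K" using 2 \<phi>1 z by auto
        ultimately have "\<exists>C\<subseteq>K. card C = Suc s \<and> \<phi> X \<notin> C \<and>
            (\<forall>c\<in>C. mono_config b A B2 {m..<m + (n + n')} \<phi> X c)"
          using False new by (intro exI[of _ "insert (\<phi> (z + x)) C"]) simp
        then show ?thesis using X by blast
      qed
    qed
  qed
  ultimately show ?case by blast
qed

text \<open>Focusing on \<open>card K\<close> colours exhausts \<open>K\<close> and leaves no colour
  for the focus, so the first alternative of \<open>vdw_focus\<close> must hold.\<close>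

lemma vdw_step:
  fixes b :: "nat \<Rightarrow> 'a::ab_group_add" and A :: "('a \<Rightarrow> 'b::ab_group_add) set"
  assumes "finite A" "\<forall>f\<in>A. f 0 = 0"
    and "\<forall>Y. finite Y \<longrightarrow> vdw b (shifted A Y p)"
  shows "vdw b A"
  unfolding vdw_def
proof (intro allI impI)
  fix m and K :: "nat set"
  assume K: "finite K"
  from vdw_focus[OF assms K, of m "card K"] obtain B n where B: "finite B" and *: "\<forall>\<phi>. \<phi> ` B \<subseteq> K \<longrightarrow>
     (\<exists>x\<in>B. mono_config b A B {m..<m + n} \<phi> x (\<phi> x)) \<or>
     (\<exists>x\<in>B. \<exists>C\<subseteq>K. card C = card K \<and> \<phi> x \<notin> C \<and> (\<forall>c\<in>C. mono_config b A B {m..<m + n} \<phi> x c))"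
    by (elim exE conjE)
  have "\<exists>x\<in>B. mono_config b A B {m..<m + n} \<phi> x (\<phi> x)" if \<phi>: "\<phi> ` B \<subseteq> K" for \<phi>
  proof -
    have "\<phi> x \<in> C" if "x \<in> B" "C \<subseteq> K" "card C = card K" for x C
    proof -
      have "C = K" using K that(2,3) by (rule card_subset_eq)
      then show ?thesis using \<phi> that(1) by auto
    qed
    then show ?thesis using *[rule_format, OF \<phi>] by blast
  qed
  then show "\<exists>B n. finite B \<and>
     (\<forall>\<phi>. \<phi> ` B \<subseteq> K \<longrightarrow> (\<exists>x\<in>B. mono_config b A B {m..<m + n} \<phi> x (\<phi> x)))"
    using B by blast
qed

text \<open>The zero map only asks that \<open>x\<close> lie in \<open>B\<close> and have its own
  colour. Hence the induction may discard it.\<close>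

lemma vdw_insert_0:
  assumes "vdw b (A - {\<lambda>_. 0})"
  shows "vdw b A"
proof -
  have ins: "mono_config b A B I \<phi> x (\<phi> x)"
    if "mono_config b (A - {\<lambda>_. 0}) B I \<phi> x (\<phi> x)" "x \<in> B" for B I \<phi> x
  proof -
    from that(1)[unfolded mono_config_def] obtain \<alpha> where \<alpha>: "\<alpha> \<noteq> {}" "\<alpha> \<subseteq> I"
      and f: "\<forall>f\<in>A - {\<lambda>_. 0}. x + f (sum b \<alpha>) \<in> B \<and> \<phi> (x + f (sum b \<alpha>)) = \<phi> x"
      by (elim exE conjE)
    have "x + f (sum b \<alpha>) \<in> B \<and> \<phi> (x + f (sum b \<alpha>)) = \<phi> x" if "f \<in> A" for f
    proof (cases "f = (\<lambda>_. 0)")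
      case True
      then show ?thesis using \<open>x \<in> B\<close> by simp
    next
      case False
      then have "f \<in> A - {\<lambda>_. 0}" using that by simp
      with f show ?thesis by (rule bspec)
    qed
    then show ?thesis using \<alpha> by (intro mono_configI[of \<alpha>])
  qed
  show ?thesis
    unfolding vdw_def
  proof (intro allI impI)
    fix m and K :: "nat set"
    assume K: "finite K"
    obtain B n where B: "finite B" and \<phi>: "\<And>\<phi>. \<phi> ` B \<subseteq> K \<Longrightarrow>
        \<exists>x\<in>B. mono_config b (A - {\<lambda>_. 0}) B {m..<m + n} \<phi> x (\<phi> x)"
      by (rule vdwE[OF assms K, where m = m]) blast
    show "\<exists>B n. finite B \<and> (\<forall>\<phi>. \<phi> ` B \<subseteq> K \<longrightarrow> (\<exists>x\<in>B. mono_config b A B {m..<m + n} \<phi> x (\<phi> x)))"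
    proof (intro exI[of _ B] exI[of _ n] conjI B allI impI)
      fix \<phi> assume "\<phi> ` B \<subseteq> K"
      from \<phi>[OF this] obtain x where x: "x \<in> B"
        and "mono_config b (A - {\<lambda>_. 0}) B {m..<m + n} \<phi> x (\<phi> x)" by (rule bexE)
      from ins[OF this(2,1)] x show "\<exists>x\<in>B. mono_config b A B {m..<m + n} \<phi> x (\<phi> x)"
        by (rule bexI)
    qed
  qed
qed

lemma vdw_empty: "vdw b ({} :: ('a::ab_group_add \<Rightarrow> 'b::ab_group_add) set)"
proof -
  have "mono_config b ({} :: ('a \<Rightarrow> 'b) set) B {m..<m + 1} \<phi> x c" for B m \<phi> x c
    by (rule mono_configI[of "{m}"]) auto
  then show ?thesis
    unfolding vdw_def by (intro allI impI exI[of _ "{0}"] exI[of _ 1]) simp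
qed

text \<open>PET induction. A pair \<open>(g, k)\<close> in \<open>L\<close> stands for the class of polynomials of degree \<open>k + 1\<close>
  with the same leading part as \<open>g\<close>. Subtracting a representative of minimal degree replaces its
  class by finitely many classes of smaller degree and preserves the degrees of all others.\<close>

lemma vdw_cover:
  fixes b :: "nat \<Rightarrow> 'a::ab_group_add" and A :: "('a \<Rightarrow> 'b::ab_group_add) set"
    and L :: "(('a \<Rightarrow> 'b) \<times> nat) multiset"
  assumes "finite A"
    and "\<And>g k. (g, k) \<in># L \<Longrightarrow> g \<in> poly0 (Suc k)"
    and "\<And>f. f \<in> A \<Longrightarrow> f \<noteq> (\<lambda>_. 0) \<Longrightarrow> \<exists>(g, k)\<in>#L. (\<lambda>x. f x - g x) \<in> poly0 k"
  shows "vdw b A"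
  using assms
proof (induction "image_mset snd L" arbitrary: L A rule: wf_induct_rule[OF wf_mult1[OF wf_less_than]])
  case (1 L A)
  note fin = 1(2) and L = 1(3) and cover = 1(4)
  define A0 where "A0 = A - {\<lambda>_. 0}"
  have A0: "finite A0" using fin A0_def by auto
  have cover0: "\<exists>(g, k)\<in>#L. (\<lambda>x. f x - g x) \<in> poly0 k" if "f \<in> A0" for f
    using cover that A0_def by auto
  have zero: "\<forall>f\<in>A0. f 0 = 0"
  proof
    fix f assume f: "f \<in> A0"
    obtain g k where "(g, k) \<in># L" "(\<lambda>x. f x - g x) \<in> poly0 k" using cover0[OF f] by auto
    then show "f 0 = 0" using poly0_at_0[of "\<lambda>x. f x - g x" k] L[of g k] poly0_at_0[of g "Suc k"] by auto
  qed
  show ?case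
  proof (cases "L = {#}")
    case True
    then have "A0 = {}" using cover0 by auto
    then show ?thesis using vdw_insert_0 vdw_empty A0_def by metis
  next
    case False
    then obtain q where "q \<in># L" by (rule multiset_nonemptyE)
    from ex_has_least_nat[of "\<lambda>q. q \<in># L", OF this, of snd]
    obtain p k where pk: "(p, k) \<in># L" and min: "\<And>g j. (g, j) \<in># L \<Longrightarrow> k \<le> j"
      by fastforce
    obtain M where M: "L = add_mset (p, k) M" using pk by (metis insert_DiffM)
    have "\<forall>Y. finite Y \<longrightarrow> vdw b (shifted A0 Y p)"
    proof (intro allI impI)
      fix Y :: "'a set" assume Y: "finite Y"
      \<comment> \<open>The nonzero shifts arising from the class of \<open>p\<close> have degree at
        most \<open>k\<close> and so fall into \<open>S\<close>. In \<open>L'\<close> each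
        represents itself, with entry \<open>k - 1\<close> because entries are one below the
        degree.\<close>
      define S where "S = {h \<in> shifted A0 Y p. h \<noteq> (\<lambda>_. 0) \<and> h \<in> poly0 k}"
      have finS: "finite (shifted A0 Y p)" unfolding shifted_def using A0 Y by auto
      then have S: "finite S" unfolding S_def by auto
      \<comment> \<open>\<open>poly0 0\<close> contains only the zero map, so \<open>k - 1\<close>
        is a genuine predecessor.\<close>
      have kpos: "k \<noteq> 0" if "h \<in> S" for h using that unfolding S_def by (cases k) auto
      define L' where "L' = image_mset (\<lambda>(g, j). (\<lambda>x. g x - p x, j)) M
                             + image_mset (\<lambda>h. (h, k - 1)) (mset_set S)"
      have "(image_mset snd L', image_mset snd L) \<in> mult1 less_than"
      proof (rule mult1I)
        show "image_mset snd L = add_mset k (image_mset snd M)" using M by simp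
        show "image_mset snd L' = image_mset snd M + image_mset (\<lambda>h. k - 1) (mset_set S)"
          unfolding L'_def by (simp add: image_mset.compositionality comp_def case_prod_beta)
        show "(j, k) \<in> less_than" if "j \<in># image_mset (\<lambda>h. k - 1) (mset_set S)" for j
          using that kpos S by auto
      qed
      moreover have "g \<in> poly0 (Suc j)" if gj: "(g, j) \<in># L'" for g j
      proof -
        consider g' where "(g', j) \<in># M" "g = (\<lambda>x. g' x - p x)" | "g \<in> S" "j = k - 1"
          using gj S unfolding L'_def by auto
        then show ?thesis
        proof cases
          case 1
          then have "(g', j) \<in># L" using M by auto
          then show ?thesis
            using 1 L min poly0_diff poly0_mono[of "Suc k" "Suc j" p] pk by (metis Suc_le_mono)
        next
          case 2
          then have "Suc j = k" using kpos by auto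
          with 2 show ?thesis by (auto simp: S_def simp del: poly0.simps)
        qed
      qed
      moreover have "\<exists>(g, j)\<in>#L'. (\<lambda>x. h x - g x) \<in> poly0 j"
        if h: "h \<in> shifted A0 Y p" "h \<noteq> (\<lambda>_. 0)" for h
      proof -
        obtain f y where f: "f \<in> A0" and h_eq: "h = (\<lambda>x. f (x + y) - f y - p x)"
          using h(1) unfolding shifted_def by auto
        obtain g j where gj: "(g, j) \<in># L" and fg: "(\<lambda>x. f x - g x) \<in> poly0 j"
          using cover0[OF f] by auto
        have "(\<lambda>x. (f x - g x) + g x) \<in> poly0 (Suc j)"
          by (intro poly0_add poly0_Suc fg L gj)
        then have "f \<in> poly0 (Suc j)" by simp
        then have "(\<lambda>x. f (x + y) - f x - f y) \<in> poly0 j" by simp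
        \<comment> \<open>The shift by \<open>y\<close> alters \<open>f\<close> only in degree at
          most \<open>j\<close>, so the leading part is still that of \<open>g\<close>.\<close>
        from poly0_add[OF this fg] have *: "(\<lambda>x. f (x + y) - f y - g x) \<in> poly0 j"
          by (simp add: algebra_simps)
        consider "(g, j) \<in># M" | "g = p" "j = k" using gj M by auto
        then show ?thesis
        proof cases
          case 1
          then have "(\<lambda>x. g x - p x, j) \<in># L'" unfolding L'_def by force
          moreover have "(\<lambda>x. h x - (g x - p x)) \<in> poly0 j" using * unfolding h_eq by (simp add: algebra_simps)
          ultimately show ?thesis by fast
        next
          case 2
          then have "h \<in> S" using * h unfolding S_def h_eq by auto
          then have "(h, k - 1) \<in># L'" unfolding L'_def using S by auto
          moreover have "(\<lambda>x. h x - h x) \<in> poly0 (k - 1)" by (simp add: zero_in_poly0)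
          ultimately show ?thesis by fast
        qed
      qed
      ultimately show "vdw b (shifted A0 Y p)" by (rule 1(1)[of L', OF _ finS])
    qed
    from vdw_step[OF A0 zero this] show ?thesis unfolding A0_def by (rule vdw_insert_0)
  qed
qed

text \<open>Every member of \<open>A\<close> serves as its own class representative.\<close>

theorem IP_polynomial_van_der_Waerden:
  assumes "finite A" "\<And>f. f \<in> A \<Longrightarrow> \<exists>k. f \<in> poly0 k"
  shows "vdw b A"
proof -
  obtain d where d: "\<And>f. f \<in> A \<Longrightarrow> f \<in> poly0 (d f)" using assms(2) by metis
  show ?thesis
  proof (rule vdw_cover[where L = "image_mset (\<lambda>f. (f, d f)) (mset_set A)"])
    show "\<exists>(g, k)\<in>#image_mset (\<lambda>f. (f, d f)) (mset_set A). (\<lambda>x. f x - g x) \<in> poly0 k" if "f \<in> A" for f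
      using that assms(1) by (auto simp: zero_in_poly0 intro!: bexI[of _ f])
  qed (use assms d poly0_Suc in \<open>auto simp del: poly0.simps\<close>)
qed

section \<open>Thick sets\<close>

definition thick :: "'a::ab_group_add set \<Rightarrow> bool" where
  "thick T \<longleftrightarrow> (\<forall>K. finite K \<longrightarrow> (\<exists>t. \<forall>k\<in>K. t + k \<in> T))"

text \<open>Choose \<open>b n\<close> so that it translates all sums of earlier terms into
  \<open>T\<close>; a nonempty sum is then placed in \<open>T\<close> by its largest index.\<close>

lemma thick_IP:
  assumes "thick T"
  shows "\<exists>b :: nat \<Rightarrow> 'a::ab_group_add. \<forall>\<alpha>. finite \<alpha> \<longrightarrow> \<alpha> \<noteq> {} \<longrightarrow> sum b \<alpha> \<in> T"
proof -
  obtain t where t: "\<And>K k. finite K \<Longrightarrow> k \<in> K \<Longrightarrow> t K + k \<in> T"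
    using assms unfolding thick_def by metis
  \<comment> \<open>\<open>Y n\<close> consists of the subset sums of the first \<open>n\<close>
    terms, with \<open>0\<close> for the empty one.\<close>
  define Y where "Y n = ((\<lambda>Y. Y \<union> (+) (t Y) ` Y) ^^ n) {0}" for n
  define b where "b n = t (Y n)" for n
  have Y0: "Y 0 = {0}" and YS: "Y (Suc n) = Y n \<union> (+) (b n) ` Y n" for n
    by (simp_all add: Y_def b_def)
  have fin: "finite (Y n)" for n by (induction n) (auto simp: Y0 YS)
  have mem: "sum b \<alpha> \<in> Y n" if "\<alpha> \<subseteq> {..<n}" for \<alpha> n
    using that
  proof (induction n arbitrary: \<alpha>)
    case (Suc n)
    then have IH: "sum b (\<alpha> - {n}) \<in> Y n" using lessThan_Suc by (metis Diff_subset_conv insert_is_Un)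
    have "finite \<alpha>" using Suc.prems finite_subset by blast
    then show ?case
      using IH by (cases "n \<in> \<alpha>") (auto simp: YS sum.remove)
  qed (simp add: Y0)
  have "sum b \<alpha> \<in> T" if "finite \<alpha>" "\<alpha> \<noteq> {}" for \<alpha>
  proof -
    have "\<alpha> - {Max \<alpha>} \<subseteq> {..<Max \<alpha>}" using that by (auto simp: le_neq_implies_less)
    from mem[OF this] have "b (Max \<alpha>) + sum b (\<alpha> - {Max \<alpha>}) \<in> T"
      unfolding b_def using t fin by blast
    then show ?thesis using that sum.remove[of \<alpha> "Max \<alpha>" b] by simp
  qed
  then show ?thesis by blast
qed

text \<open>Translate by a constant vector exceeding all coordinates of the finite set in absolute
  value.\<close>

lemma thick_nonzero: "thick {x :: int ^ 'd. \<forall>i. x $ i \<noteq> 0}"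
  unfolding thick_def
proof (intro allI impI)
  fix K :: "(int ^ 'd) set"
  assume "finite K"
  then have fin: "finite ((\<lambda>(k, i). \<bar>k $ i\<bar>) ` (K \<times> UNIV))" by simp
  define M where "M = Max (insert 0 ((\<lambda>(k, i). \<bar>k $ i\<bar>) ` (K \<times> UNIV))) + 1"
  have less: "\<bar>k $ i\<bar> < M" if "k \<in> K" for k i
    using that fin unfolding M_def by (auto simp: less_le_trans intro!: le_imp_less_Suc Max_ge zle_add1_eq_le[THEN iffD2])
  then have "M + k $ i \<noteq> 0" if "k \<in> K" for k i using less[OF that, of i] by linarith
  then show "\<exists>t. \<forall>k\<in>K. t + k \<in> {x. \<forall>i. x $ i \<noteq> 0}"
    by (intro exI[of _ "\<chi> i. M"]) auto
qed

section \<open>Polynomial configurations in finite covers of thick sets\<close>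

text \<open>Placing \<open>a\<close> itself in \<open>C\<close> is what later makes its coordinates
  nonzero.\<close>

theorem thick_cover_polynomial:
  fixes A :: "('a::ab_group_add \<Rightarrow> 'a) set"
  assumes A: "finite A" "\<And>f. f \<in> A \<Longrightarrow> \<exists>k. f \<in> poly0 k"
    and Q: "finite Q" "thick (\<Union>Q)"
  shows "\<exists>a b. \<exists>C\<in>Q. a \<in> C \<and> b \<in> C \<and> (\<forall>f\<in>A. a + f b \<in> C)"
proof -
  obtain S where S: "S \<subseteq> Q" "thick (\<Union>S)" and min: "\<And>C. C \<in> S \<Longrightarrow> \<not> thick (\<Union>(S - {C}))"
  proof -
    let ?P = "\<lambda>S. S \<subseteq> Q \<and> thick (\<Union>S)"
    obtain S where S: "?P S" and least: "\<And>S'. ?P S' \<Longrightarrow> card S \<le> card S'"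
      using ex_has_least_nat[of ?P Q card] Q by blast
    have "finite S" using S Q finite_subset by blast
    then have "\<not> thick (\<Union>(S - {C}))" if "C \<in> S" for C
      using least[of "S - {C}"] S that card_Diff1_less[of S C] by force
    with S[THEN conjunct1] S[THEN conjunct2] show ?thesis by (rule that)
  qed
  have finS: "finite S" using S(1) Q(1) by (rule finite_subset)
  obtain b :: "nat \<Rightarrow> 'a" where b: "\<forall>\<alpha>. finite \<alpha> \<longrightarrow> \<alpha> \<noteq> {} \<longrightarrow> sum b \<alpha> \<in> \<Union>S"
    using thick_IP[OF S(2)] by (rule exE)
  \<comment> \<open>Relative syndeticity: every translate of \<open>K C\<close> meets the complement
    of the other members, so a translate inside \<open>\<Union>S\<close> must meet
    \<open>C\<close>.\<close>
  have "\<forall>C\<in>S. \<exists>K. finite K \<and> (\<forall>t. \<exists>k\<in>K. t + k \<notin> \<Union>(S - {C}))"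
  proof
    fix C assume "C \<in> S"
    from min[OF this] show "\<exists>K. finite K \<and> (\<forall>t. \<exists>k\<in>K. t + k \<notin> \<Union>(S - {C}))"
      unfolding thick_def by simp
  qed
  then obtain K where "\<forall>C\<in>S. finite (K C) \<and> (\<forall>t. \<exists>k\<in>K C. t + k \<notin> \<Union>(S - {C}))"
    by (rule bchoice[THEN exE])
  then have K: "\<And>C. C \<in> S \<Longrightarrow> finite (K C)"
    "\<And>C t. C \<in> S \<Longrightarrow> \<exists>k\<in>K C. t + k \<notin> \<Union>(S - {C})" by simp_all
  have finP: "finite (Pi\<^sub>E S K)" using finS K by (intro finite_PiE)
  from finite_imp_inj_to_nat_seg[OF this]
  obtain e :: "('a set \<Rightarrow> 'a) \<Rightarrow> nat" where e: "inj_on e (Pi\<^sub>E S K)"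
    by (elim exE conjE)
  have "vdw b A" by (rule IP_polynomial_van_der_Waerden[OF A])
  then obtain B n where B: "finite B"
    and mono: "\<And>\<phi>. \<phi> ` B \<subseteq> e ` Pi\<^sub>E S K \<Longrightarrow> \<exists>x\<in>B. mono_config b A B {0..<n} \<phi> x (\<phi> x)"
    using finite_imageI[OF finP, of e] by (rule vdwE[where m = 0, unfolded add_0]) blast
  have "finite ((\<lambda>(u, k). u + k) ` (B \<times> (\<Union>C\<in>S. K C)))" using B finS K by auto
  \<comment> \<open>One \<open>t\<close> moves every point of \<open>B\<close>, together with all
    its candidate return times, into \<open>\<Union>S\<close>.\<close>
  from S(2)[unfolded thick_def, rule_format, OF this]
  obtain t where t: "\<forall>v\<in>(\<lambda>(u, k). u + k) ` (B \<times> (\<Union>C\<in>S. K C)). t + v \<in> \<Union>S"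
    by (elim exE) blast
  have ex: "\<exists>k. k \<in> K C \<and> t + u + k \<in> C" if uC: "u \<in> B" "C \<in> S" for u C
  proof -
    obtain k where k: "k \<in> K C" "t + u + k \<notin> \<Union>(S - {C})" using K(2)[OF uC(2), of "t + u"] by (rule bexE)
    then have "t + (u + k) \<in> \<Union>S" using t uC by auto
    then show ?thesis using k by (auto simp: add.assoc)
  qed
  define \<kappa> where "\<kappa> u C = (SOME k. k \<in> K C \<and> t + u + k \<in> C)" for u C
  have \<kappa>: "\<kappa> u C \<in> K C \<and> t + u + \<kappa> u C \<in> C" if "u \<in> B" "C \<in> S" for u C
    unfolding \<kappa>_def using ex[OF that] by (rule someI_ex)
  \<comment> \<open>The colour of \<open>u\<close> encodes the return times of \<open>t + u\<close>
    to all members at once, as the member containing \<open>sum b \<alpha>\<close> is not known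
    beforehand.\<close>
  define \<phi> where "\<phi> u = e (restrict (\<kappa> u) S)" for u
  have \<kappa>P: "restrict (\<kappa> u) S \<in> Pi\<^sub>E S K" if "u \<in> B" for u using \<kappa> that by auto
  then have "\<phi> ` B \<subseteq> e ` Pi\<^sub>E S K" unfolding \<phi>_def by auto
  from mono[OF this] obtain x \<alpha> where \<alpha>: "\<alpha> \<noteq> {}" "\<alpha> \<subseteq> {0..<n}" and x: "x \<in> B"
    and f: "\<And>f. f \<in> A \<Longrightarrow> x + f (sum b \<alpha>) \<in> B \<and> \<phi> (x + f (sum b \<alpha>)) = \<phi> x"
    unfolding mono_config_def by blast
  have "finite \<alpha>" using \<alpha> finite_subset by blast
  then obtain C where C: "C \<in> S" "sum b \<alpha> \<in> C"
    using b[rule_format, of \<alpha>] \<alpha>(1) by auto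
  \<comment> \<open>Equal colours give equal return times to \<open>C\<close>, so the single point
    \<open>a = t + x + \<kappa> x C\<close> works for every \<open>f\<close>.\<close>
  have "t + x + \<kappa> x C + f (sum b \<alpha>) \<in> C" if "f \<in> A" for f
  proof -
    let ?u = "x + f (sum b \<alpha>)"
    have "restrict (\<kappa> ?u) S = restrict (\<kappa> x) S"
      using f[OF that] \<kappa>P x e unfolding \<phi>_def by (metis inj_onD)
    then have "\<kappa> ?u C = \<kappa> x C" using C by (metis restrict_apply')
    then show ?thesis using \<kappa>[of ?u C] f[OF that] C by (simp add: algebra_simps)
  qed
  moreover have "t + x + \<kappa> x C \<in> C" using \<kappa> x C by blast
  ultimately show ?thesis using C S by blast
qed

theorem corollary1p10:
  fixes F :: "(int ^ 'd::finite \<Rightarrow> int) set"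
    and P :: "(int ^ 'd) set set"
  assumes "finite F"
    and "\<And>f. f \<in> F \<Longrightarrow> polynomial_map f"
    and "\<And>f. f \<in> F \<Longrightarrow> f 0 = 0"
    and "finite P"
    and "partition_on UNIV P"
  shows "\<exists>a b :: int ^ 'd. (\<forall>i. a $ i \<noteq> 0) \<and> (\<forall>i. b $ i \<noteq> 0) \<and>
           (\<exists>C\<in>P. {b} \<union> {a + (\<chi> i. f i b) | f :: 'd \<Rightarrow> int ^ 'd \<Rightarrow> int. \<forall>i. f i \<in> F} \<subseteq> C)"
proof -
  define NZ where "NZ = {x :: int ^ 'd. \<forall>i. x $ i \<noteq> 0}"
  \<comment> \<open>Cutting the cells down to \<open>NZ\<close> forces nonzero coordinates and keeps
    the union thick.\<close>
  define Q where "Q = (\<lambda>C. C \<inter> NZ) ` P"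
  \<comment> \<open>Each choice of a polynomial per coordinate becomes one map of the group into
    itself.\<close>
  define A where "A = (\<lambda>f x. \<chi> i. f i x) ` (UNIV \<rightarrow>\<^sub>E F :: ('d \<Rightarrow> int ^ 'd \<Rightarrow> int) set)"
  have "\<Union>Q = NZ" using assms(5) unfolding Q_def partition_on_def by auto
  then have "thick (\<Union>Q)" using thick_nonzero NZ_def by metis
  moreover have "finite Q" using assms(4) Q_def by auto
  moreover have "finite A" unfolding A_def using assms(1) by (intro finite_imageI finite_PiE) auto
  moreover have "\<exists>k. g \<in> poly0 k" if g: "g \<in> A" for g
  proof -
    obtain f where "f \<in> UNIV \<rightarrow>\<^sub>E F" and g_eq: "g = (\<lambda>x. \<chi> i. f i x)"
      using g unfolding A_def by blast
    then have f: "f i \<in> F" for i by auto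
    have "\<forall>i. \<exists>k. f i \<in> poly0 k" using polynomial_map_imp_poly0 f assms by blast
    then obtain k where k: "\<And>i. f i \<in> poly0 (k i)" by metis
    have "f i \<in> poly0 (Max (range k))" for i by (rule poly0_mono[OF _ k]) simp
    then have "g \<in> poly0 (Max (range k))" unfolding g_eq by (intro poly0_vec) simp
    then show ?thesis by blast
  qed
  ultimately obtain a b C where C: "C \<in> Q" and ab: "a \<in> C" "b \<in> C" "\<And>f. f \<in> A \<Longrightarrow> a + f b \<in> C"
    using thick_cover_polynomial[of A Q] by blast
  obtain C' where C': "C' \<in> P" "C = C' \<inter> NZ" using C unfolding Q_def by blast
  have "a + (\<chi> i. f i b) \<in> C'" if "\<forall>i. f i \<in> F" for f
    using ab(3)[of "\<lambda>x. \<chi> i. f i x"] that C' unfolding A_def by auto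
  then have "{b} \<union> {a + (\<chi> i. f i b) | f. \<forall>i. f i \<in> F} \<subseteq> C'" using ab(2) C' by auto
  moreover have "\<forall>i. a $ i \<noteq> 0" "\<forall>i. b $ i \<noteq> 0" using ab(1,2) C' NZ_def by auto
  ultimately show ?thesis using C'(1) by (intro exI[of _ a] exI[of _ b] conjI bexI[of _ C'])
qed

end
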